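(* Assume the cumulative incidence functions satisfy $F_1(t)\le F_2(t)\le\cdots\le F_k(t)$ for all $t\ge 0$. Let $\hat F_1^*,\ldots,\hat F_k^*$ be the order-restricted estimators based on $n$ observations, and let $\|g\|=\sup_{t\ge 0}|g(t)|$. Then $$P\left[\,\|\hat F_i^*-F_i\|\to 0 \text{ as } n\to\infty,\ i=1,2,\ldots,k\right]=1.$$
   Context: Competing risks model: $k\ge 3$ is fixed, $(T,\delta)$ is a random pair with $T\ge 0$ (failure time) having a continuous distribution function $F$, and $\delta\in\{1,\ldots,k\}$ (cause of failure). The cumulative incidence function of cause $j$ is $F_j(t)=P[T\le t,\ \delta=j]$, so $F=\sum_{j=1}^k F_j$. One observes i.i.d. copies $(T_i,\delta_i)$, $i=1,2,\ldots$, of $(T,\delta)$; estimators are based on the first $n$ of them. Unrestricted estimators: $\hat F_j(t)=\frac1n\sum_{i=1}^n I(T_i\le t,\ \delta_i=j)$, $j=1,\ldots,k$. Restricted estimators: for $1\le i\le k$ and each $t$, $$\hat F_i^*(t)=\max_{1\le r\le i}\ \min_{i\le s\le k}\ \frac{\sum_{j=r}^{s}\hat F_j(t)}{s-r+1},$$ i.e. $(\hat F_1^*(t),\ldots,\hat F_k^*(t))$ is the equal-weights least squares projection of $(\hat F_1(t),\ldots,\hat F_k(t))$ onto the cone $\{x\in\mathbb R^k: x_1\le x_2\le\cdots\le x_k\}$. *)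

theory Defs
  imports "HOL-Probability.Probability"
begin

text \<open>Causes of failure are the natural numbers \<open>1, \<dots>, k\<close>; observations are indexed from \<open>1\<close>.\<close>

definition cumulative_incidence ::
  "'a measure \<Rightarrow> ('a \<Rightarrow> real) \<Rightarrow> ('a \<Rightarrow> nat) \<Rightarrow> nat \<Rightarrow> real \<Rightarrow> real" where
  "cumulative_incidence M T \<delta> j t = measure M {\<omega> \<in> space M. T \<omega> \<le> t \<and> \<delta> \<omega> = j}"

definition empirical_cif ::
  "(nat \<Rightarrow> 'a \<Rightarrow> real) \<Rightarrow> (nat \<Rightarrow> 'a \<Rightarrow> nat) \<Rightarrow> nat \<Rightarrow> 'a \<Rightarrow> nat \<Rightarrow> real \<Rightarrow> real" where
  "empirical_cif Ts \<delta>s n \<omega> j t =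
     (1 / real n) * (\<Sum>i=1..n. of_bool (Ts i \<omega> \<le> t \<and> \<delta>s i \<omega> = j))"

definition restricted_cif ::
  "nat \<Rightarrow> (nat \<Rightarrow> 'a \<Rightarrow> real) \<Rightarrow> (nat \<Rightarrow> 'a \<Rightarrow> nat) \<Rightarrow> nat \<Rightarrow> 'a \<Rightarrow> nat \<Rightarrow> real \<Rightarrow> real" where
  "restricted_cif k Ts \<delta>s n \<omega> i t =
     (MAX r\<in>{1..i}. MIN s\<in>{i..k}.
        (\<Sum>j=r..s. empirical_cif Ts \<delta>s n \<omega> j t) / (real s - real r + 1))"

text \<open>A supremum in the reals, so meaningful only for functions bounded on \<open>[0, \<infinity>)\<close>.
  Cumulative incidence functions and both estimators take values in \<open>[0, 1]\<close>.\<close>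

definition sup_norm :: "(real \<Rightarrow> real) \<Rightarrow> real" where
  "sup_norm g = (SUP t\<in>{0..}. \<bar>g t\<bar>)"

end

theory Submission
  imports Defs
begin

text \<open>Hoeffding's inequality and Borel--Cantelli give the strong law for indicators, so almost
  surely every \<open>empirical_cif\<close> converges at all rational times and at infinity. As the limits are
  continuous and everything is monotone in time, the convergence is uniform. Finally, if all
  unrestricted estimators are within \<open>e\<close> of the ordered \<open>F\<^sub>j\<close>, then so are the restricted ones:
  taking \<open>r = i\<close> in the maximum gives averages of estimates of \<open>F\<^sub>j\<close> with \<open>j \<ge> i\<close>, and taking
  \<open>s = i\<close> in the minimum gives averages of estimates of \<open>F\<^sub>j\<close> with \<open>j \<le> i\<close>. The event is measurable
  because the estimators are right-continuous step functions of time, so that the supremum norm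
  may be taken over the rationals.\<close>

section \<open>Averages over blocks of causes and bounds for the max-min formula\<close>

lemma interval_mean_ge:
  fixes a :: "nat \<Rightarrow> real"
  assumes "r \<le> s" "\<And>j. j \<in> {r..s} \<Longrightarrow> c \<le> a j"
  shows "c \<le> (\<Sum>j=r..s. a j) / (real s - real r + 1)"
proof -
  have "of_nat (card {r..s}) * c \<le> (\<Sum>j=r..s. a j)"
    using assms by (intro sum_bounded_below) auto
  moreover have "real (card {r..s}) = real s - real r + 1"
    using assms(1) by (simp add: of_nat_diff)
  moreover have "real s - real r + 1 > 0"
    using assms(1) by simp
  ultimately show ?thesis
    by (simp add: field_simps)
qed

lemma interval_mean_le:
  fixes a :: "nat \<Rightarrow> real"
  assumes "r \<le> s" "\<And>j. j \<in> {r..s} \<Longrightarrow> a j \<le> c"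
  shows "(\<Sum>j=r..s. a j) / (real s - real r + 1) \<le> c"
  using interval_mean_ge[of r s "- c" "\<lambda>j. - a j"] assms by (simp add: sum_negf)

text \<open>A one-sided hypothesis suffices: the choice \<open>r = i\<close> in the maximum leaves
  only block averages starting at \<open>i\<close>, which never involve a smaller index.\<close>

lemma restricted_cif_ge:
  assumes "i \<in> {1..k}" "\<And>j. j \<in> {i..k} \<Longrightarrow> c \<le> empirical_cif Ts \<delta>s n \<omega> j t"
  shows "c \<le> restricted_cif k Ts \<delta>s n \<omega> i t"
proof -
  have "c \<le> (MIN s\<in>{i..k}.
      (\<Sum>j=i..s. empirical_cif Ts \<delta>s n \<omega> j t) / (real s - real i + 1))"
    using assms by (subst Min_ge_iff) (auto intro!: interval_mean_ge)
  then show ?thesis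
    unfolding restricted_cif_def using assms(1) by (subst Max_ge_iff) (auto intro!: bexI[of _ i])
qed

lemma restricted_cif_le:
  assumes "i \<in> {1..k}" "\<And>j. j \<in> {1..i} \<Longrightarrow> empirical_cif Ts \<delta>s n \<omega> j t \<le> c"
  shows "restricted_cif k Ts \<delta>s n \<omega> i t \<le> c"
proof -
  have "(MIN s\<in>{i..k}.
      (\<Sum>j=r..s. empirical_cif Ts \<delta>s n \<omega> j t) / (real s - real r + 1)) \<le> c"
    if "r \<in> {1..i}" for r
    using assms that
    by (subst Min_le_iff) (auto intro!: bexI[of _ i] interval_mean_le)
  then show ?thesis
    unfolding restricted_cif_def using assms(1) by (subst Max_le_iff) auto
qed

lemma empirical_cif_nonneg: "0 \<le> empirical_cif Ts \<delta>s n \<omega> j t"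
  unfolding empirical_cif_def by (intro mult_nonneg_nonneg sum_nonneg) auto

lemma empirical_cif_le_1: "empirical_cif Ts \<delta>s n \<omega> j t \<le> 1"
proof -
  have "(\<Sum>i=1..n. of_bool (Ts i \<omega> \<le> t \<and> \<delta>s i \<omega> = j)) \<le> (\<Sum>i=1..n. 1::real)"
    by (intro sum_mono) auto
  then show ?thesis
    unfolding empirical_cif_def by (cases "n = 0") (simp_all add: field_simps)
qed

lemma mono_empirical_cif: "mono (empirical_cif Ts \<delta>s n \<omega> j)"
  unfolding empirical_cif_def by (intro monoI mult_left_mono sum_mono) auto

text \<open>Keeps the estimation error bounded, so that its suprema over sets of times are genuine
  real suprema.\<close>

lemma abs_restricted_cif_diff_le_1:
  assumes "i \<in> {1..k}" "0 \<le> x" "x \<le> 1"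
  shows "\<bar>restricted_cif k Ts \<delta>s n \<omega> i t - x\<bar> \<le> 1"
  using restricted_cif_ge[OF assms(1), of 0 Ts \<delta>s n \<omega> t, OF empirical_cif_nonneg]
    restricted_cif_le[OF assms(1), of Ts \<delta>s n \<omega> t 1, OF empirical_cif_le_1] assms
  by linarith

section \<open>Reduction of the supremum norm to rational times\<close>

text \<open>Finitely many sample points leave a gap immediately to the right of \<open>t\<close>,
  and every such gap contains a rational.\<close>

lemma rational_right_step_eq:
  fixes x :: "nat \<Rightarrow> real"
  assumes "d > 0"
  obtains q where "q \<in> \<rat>" "t < q" "q < t + d" "\<And>i. i \<in> {1..n} \<Longrightarrow> x i \<le> q \<longleftrightarrow> x i \<le> t"
proof -
  \<comment> \<open>The first sample point beyond \<open>t\<close>, capped at \<open>t + d\<close>;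
    the inserted cap also keeps the set nonempty.\<close>
  define m where "m = Min (insert (t + d) {x i | i. i \<in> {1..n} \<and> x i > t})"
  have fin: "finite (insert (t + d) {x i | i. i \<in> {1..n} \<and> x i > t})"
    by simp
  have "t < m"
    unfolding m_def using assms by (subst Min_gr_iff[OF fin]) auto
  then obtain q where q: "q \<in> \<rat>" "t < q" "q < m"
    using Rats_dense_in_real by blast
  have m: "m \<le> y" if "y \<in> insert (t + d) {x i | i. i \<in> {1..n} \<and> x i > t}" for y
    unfolding m_def using fin that by (rule Min_le)
  show thesis
  proof
    show "q < t + d"
      using q m[of "t + d"] by simp
    show "x i \<le> q \<longleftrightarrow> x i \<le> t" if "i \<in> {1..n}" for i
    proof (cases "x i > t")
      case True
      with that have "m \<le> x i"
        by (intro m) blast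
      with True q show ?thesis
        by simp
    qed (use q in simp)
  qed (use q in auto)
qed

text \<open>Time enters the estimator only through the comparisons
  \<open>Ts i \<omega> \<le> t\<close>. A rational \<open>q\<close> that changes none of them leaves
  all unrestricted estimators, hence the whole max-min expression, unchanged.\<close>

lemma restricted_cif_rational_right:
  assumes "d > 0"
  obtains q where "q \<in> \<rat>" "t < q" "q < t + d"
    "restricted_cif k Ts \<delta>s n \<omega> i q = restricted_cif k Ts \<delta>s n \<omega> i t"
proof -
  obtain q where q: "q \<in> \<rat>" "t < q" "q < t + d"
      "\<And>i. i \<in> {1..n} \<Longrightarrow> Ts i \<omega> \<le> q \<longleftrightarrow> Ts i \<omega> \<le> t"
    using rational_right_step_eq[OF assms, of t n "\<lambda>i. Ts i \<omega>"] by blast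
  have "empirical_cif Ts \<delta>s n \<omega> j q = empirical_cif Ts \<delta>s n \<omega> j t" for j
    unfolding empirical_cif_def using q(4) by (intro arg_cong2[of _ _ _ _ "(*)"] sum.cong) auto
  then show thesis
    using q that unfolding restricted_cif_def by simp
qed

text \<open>Replaces an uncountable supremum by a countable one, which preserves measurability in
  \<omega>.\<close>

lemma sup_norm_eq_SUP_rational:
  assumes bdd: "\<And>t. t \<ge> 0 \<Longrightarrow> \<bar>g t\<bar> \<le> B"
    and approx: "\<And>t e. t \<ge> 0 \<Longrightarrow> e > 0 \<Longrightarrow> \<exists>q\<in>\<rat>. q \<ge> 0 \<and> \<bar>g t\<bar> \<le> \<bar>g q\<bar> + e"
  shows "sup_norm g = (SUP q\<in>\<rat> \<inter> {0..}. \<bar>g q\<bar>)"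
  unfolding sup_norm_def
proof (rule antisym)
  have bdd': "bdd_above ((\<lambda>t. \<bar>g t\<bar>) ` A)" if "A \<subseteq> {0..}" for A
    using bdd that by (intro bdd_aboveI2[of _ _ B]) auto
  show "(SUP q\<in>\<rat> \<inter> {0..}. \<bar>g q\<bar>) \<le> (SUP t\<in>{0..}. \<bar>g t\<bar>)"
    by (rule cSUP_subset_mono) (use bdd' Rats_0 in auto)
  show "(SUP t\<in>{0..}. \<bar>g t\<bar>) \<le> (SUP q\<in>\<rat> \<inter> {0..}. \<bar>g q\<bar>)"
  proof (rule cSUP_least)
    fix t :: real assume t: "t \<in> {0..}"
    show "\<bar>g t\<bar> \<le> (SUP q\<in>\<rat> \<inter> {0..}. \<bar>g q\<bar>)"
    proof (rule field_le_epsilon)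
      fix e :: real assume "e > 0"
      then obtain q where q: "q \<in> \<rat>" "q \<ge> 0" "\<bar>g t\<bar> \<le> \<bar>g q\<bar> + e"
        using approx[of t e] t by auto
      have "\<bar>g q\<bar> \<le> (SUP q\<in>\<rat> \<inter> {0..}. \<bar>g q\<bar>)"
        using q by (intro cSUP_upper bdd') auto
      then show "\<bar>g t\<bar> \<le> (SUP q\<in>\<rat> \<inter> {0..}. \<bar>g q\<bar>) + e"
        using q by simp
    qed
  qed auto
qed

lemma sup_norm_LIMSEQ_0I:
  assumes "\<And>e. e > 0 \<Longrightarrow> \<forall>\<^sub>F n in sequentially. \<forall>t\<ge>0. \<bar>g n t\<bar> \<le> e"
  shows "(\<lambda>n. sup_norm (g n)) \<longlonglongrightarrow> 0"
proof (rule tendstoI)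
  fix e :: real assume "e > 0"
  then have "\<forall>\<^sub>F n in sequentially. \<forall>t\<ge>0. \<bar>g n t\<bar> \<le> e / 2"
    using assms[of "e / 2"] by simp
  then show "\<forall>\<^sub>F n in sequentially. dist (sup_norm (g n)) 0 < e"
  proof eventually_elim
    case (elim n)
    have "sup_norm (g n) \<le> e / 2"
      unfolding sup_norm_def using elim by (intro cSUP_least) auto
    \<comment> \<open>The value at \<open>0\<close> shows that the supremum is nonnegative; the
      eventual bound \<open>e / 2\<close> makes the set of values bounded above.\<close>
    moreover have "\<bar>g n 0\<bar> \<le> sup_norm (g n)"
      unfolding sup_norm_def using elim by (intro cSUP_upper bdd_aboveI2[of _ _ "e / 2"]) auto
    ultimately show ?case
      using \<open>e > 0\<close> by simp
  qed
qed

text \<open>Restricting the tolerance to \<open>inverse (real (Suc m))\<close> expresses convergence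
  by quantifiers over countable sets only.\<close>

lemma pred_LIMSEQ_real:
  fixes f :: "nat \<Rightarrow> 'a \<Rightarrow> real"
  assumes [measurable]: "\<And>n. f n \<in> borel_measurable M"
  shows "Measurable.pred M (\<lambda>x. (\<lambda>n. f n x) \<longlonglongrightarrow> l)"
proof -
  have "(\<lambda>x. (\<lambda>n. f n x) \<longlonglongrightarrow> l) =
      (\<lambda>x. \<forall>m. \<exists>N. \<forall>n\<in>{N..}. \<bar>f n x - l\<bar> < inverse (real (Suc m)))"
  proof (intro ext iffI allI)
    fix x m assume "(\<lambda>n. f n x) \<longlonglongrightarrow> l"
    then show "\<exists>N. \<forall>n\<in>{N..}. \<bar>f n x - l\<bar> < inverse (real (Suc m))"
      unfolding LIMSEQ_def dist_real_def by (metis atLeast_iff inverse_Suc)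
  next
    fix x assume *: "\<forall>m. \<exists>N. \<forall>n\<in>{N..}. \<bar>f n x - l\<bar> < inverse (real (Suc m))"
    show "(\<lambda>n. f n x) \<longlonglongrightarrow> l"
    proof (rule LIMSEQ_I)
      fix e :: real assume "e > 0"
      then obtain m where "inverse (real (Suc m)) < e"
        using reals_Archimedean by blast
      with * show "\<exists>N. \<forall>n\<ge>N. norm (f n x - l) < e"
        by (metis atLeast_iff less_trans real_norm_def)
    qed
  qed
  moreover have "Measurable.pred M (\<lambda>x. \<forall>m. \<exists>N. \<forall>n\<in>{N..}. \<bar>f n x - l\<bar> < inverse (real (Suc m)))"
    by measurable
  ultimately show ?thesis
    by simp
qed

section \<open>Uniform convergence of monotone functions\<close>

text \<open>A version of Polya's theorem. On a bounded interval, monotonicity squeezes both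
  functions between their values at neighbouring points of a fine rational grid. Beyond it,
  \<open>F\<close> is already close to \<open>L\<close>, and \<open>H n\<close>, acting as the value
  of \<open>G n\<close> at infinity, caps \<open>G n\<close>.\<close>

lemma uniform_limit_monotone_rational:
  fixes F :: "real \<Rightarrow> real" and G :: "nat \<Rightarrow> real \<Rightarrow> real"
  assumes cont: "continuous_on {0..} F" and mono_F: "mono_on {0..} F" and F_L: "(F \<longlongrightarrow> L) at_top"
    and mono_G: "\<And>n. mono_on {0..} (G n)" and G_H: "\<And>n t. t \<ge> 0 \<Longrightarrow> G n t \<le> H n"
    and H_L: "H \<longlonglongrightarrow> L"
    and G_F: "\<And>q. q \<in> \<rat> \<Longrightarrow> q \<ge> 0 \<Longrightarrow> (\<lambda>n. G n q) \<longlonglongrightarrow> F q"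
  shows "uniform_limit {0..} G F sequentially"
proof (rule uniform_limitI)
  fix e :: real assume "e > 0"
  \<comment> \<open>Each one-sided estimate below costs at most two errors of size
    \<open>d\<close>.\<close>
  define d where "d = e / 2"
  have "d > 0"
    using \<open>e > 0\<close> by (simp add: d_def)
  have F_le: "F t \<le> L" if "t \<ge> 0" for t
  proof (rule tendsto_lowerbound[OF F_L])
    show "\<forall>\<^sub>F x in at_top. F t \<le> F x"
      using eventually_ge_at_top[of t] by eventually_elim (use that mono_F in \<open>auto simp: mono_on_def\<close>)
  qed simp
  have "\<forall>\<^sub>F x in at_top. F x > L - d"
    using F_L \<open>d > 0\<close> by (intro order_tendstoD(1)[OF F_L]) auto
  then obtain x where "\<And>y. y \<ge> x \<Longrightarrow> F y > L - d"
    by (auto simp: eventually_at_top_linorder)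
  then obtain m :: nat where m: "F (real m) > L - d"
    using real_arch_simple by blast
  \<comment> \<open>The extra unit leaves room for the grid cell of a time
    \<open>t \<le> real m\<close>, whose right endpoint may exceed \<open>real m\<close>.\<close>
  have "uniformly_continuous_on {0..real m + 1} F"
    by (intro compact_uniformly_continuous continuous_on_subset[OF cont]) auto
  then obtain \<eta> where \<eta>: "\<eta> > 0"
      "\<And>x y. x \<in> {0..real m + 1} \<Longrightarrow> y \<in> {0..real m + 1} \<Longrightarrow> dist y x < \<eta> \<Longrightarrow> dist (F y) (F x) < d"
    unfolding uniformly_continuous_on_def using \<open>d > 0\<close> by meson
  obtain K :: nat where K: "inverse (real (Suc K)) < \<eta>"
    using \<eta>(1) reals_Archimedean by blast
  \<comment> \<open>Multiples of \<open>1 / real (Suc K)\<close> up to \<open>m + 1\<close>: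
    finitely many rationals with spacing below \<open>\<eta>\<close>.\<close>
  define grid where "grid = (\<lambda>i. real i / real (Suc K)) ` {..(m + 1) * Suc K}"
  have ev_grid: "\<forall>\<^sub>F n in sequentially. \<forall>q\<in>grid. \<bar>G n q - F q\<bar> < d"
  proof (rule eventually_ball_finite)
    show "\<forall>q\<in>grid. \<forall>\<^sub>F n in sequentially. \<bar>G n q - F q\<bar> < d"
    proof
      fix q assume "q \<in> grid"
      then have "q \<in> \<rat>" "q \<ge> 0"
        by (auto simp: grid_def)
      then show "\<forall>\<^sub>F n in sequentially. \<bar>G n q - F q\<bar> < d"
        using tendstoD[OF G_F \<open>d > 0\<close>] by (simp add: dist_real_def)
    qed
  qed (simp add: grid_def)
  \<comment> \<open>The grid contains \<open>real m\<close> itself, which anchors the lower bound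
    for \<open>G n\<close> on the tail.\<close>
  have "real m = real (m * Suc K) / real (Suc K)"
    by (simp add: field_simps)
  then have m_grid: "real m \<in> grid"
    unfolding grid_def by (rule image_eqI) simp
  have ev_H: "\<forall>\<^sub>F n in sequentially. H n < L + d"
    using \<open>d > 0\<close> by (intro order_tendstoD(2)[OF H_L]) auto
  show "\<forall>\<^sub>F n in sequentially. \<forall>t\<in>{0..}. dist (G n t) (F t) < e"
    using ev_grid ev_H
  proof eventually_elim
    case (elim n)
    show ?case
    proof
      fix t :: real assume t: "t \<in> {0..}"
      show "dist (G n t) (F t) < e"
      proof (cases "t \<le> real m")
        case True
        \<comment> \<open>Index of the left endpoint of the grid cell containing
          \<open>t\<close>.\<close>
        define i where "i = nat \<lfloor>t * real (Suc K)\<rfloor>"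
        have i: "real i \<le> t * real (Suc K)" "t * real (Suc K) < real (Suc i)"
          using t by (auto simp: i_def) linarith
        define q q' where "q = real i / real (Suc K)" and "q' = real (Suc i) / real (Suc K)"
        have q: "0 \<le> q" "q \<le> t" "t \<le> q'"
          using i by (simp_all add: q_def q'_def field_simps)
        have "real i \<le> real m * real (Suc K)"
          using i True by (meson mult_right_mono of_nat_0_le_iff order_trans)
        then have "i \<le> m * Suc K"
          by (simp only: of_nat_mult[symmetric] of_nat_le_iff)
        then have "i \<le> (m + 1) * Suc K" "Suc i \<le> (m + 1) * Suc K"
          by simp_all
        then have grid: "q \<in> grid" "q' \<in> grid"
          unfolding grid_def q_def q'_def by blast+
        have "q' = q + inverse (real (Suc K))"
          by (simp add: q_def q'_def field_simps)
        then have "dist q' q < \<eta>"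
          using K by (simp add: dist_real_def)
        moreover have "real (Suc i) \<le> real ((m + 1) * Suc K)"
          using \<open>Suc i \<le> (m + 1) * Suc K\<close> by (simp only: of_nat_le_iff)
        then have "q' \<le> real m + 1"
          unfolding q'_def by (simp add: field_simps)
        ultimately have "dist (F q') (F q) < d"
          using q by (intro \<eta>(2)) auto
        moreover have "F q \<le> F t" "F t \<le> F q'" "G n q \<le> G n t" "G n t \<le> G n q'"
          using q t mono_F mono_G[of n] by (auto simp: mono_on_def)
        moreover have "\<bar>G n q - F q\<bar> < d" "\<bar>G n q' - F q'\<bar> < d"
          using elim(1) grid by auto
        ultimately show ?thesis
          unfolding dist_real_def d_def by linarith
      next
        case False
        have "F (real m) \<le> F t" "G n (real m) \<le> G n t"
          using False t mono_F mono_G[of n] by (auto simp: mono_on_def)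
        moreover have "\<bar>G n (real m) - F (real m)\<bar> < d"
          using elim(1) m_grid by auto
        moreover have "G n t \<le> H n" "F t \<le> L"
          using t G_H F_le by auto
        ultimately have "G n t - F t < d + d" "F t - G n t < d + d"
          using m elim(2) by linarith+
        then show ?thesis
          by (simp add: dist_real_def d_def abs_less_iff)
      qed
    qed
  qed
qed

section \<open>Strong laws for bounded variables and for frequencies\<close>

context prob_space
begin

text \<open>For each fixed tolerance, Hoeffding's bound decays geometrically in the sample size,
  hence is summable, and Borel--Cantelli applies. The variable \<open>Y\<close> only carries the
  common distribution.\<close>

lemma strong_law_bounded_iid:
  fixes X :: "nat \<Rightarrow> 'a \<Rightarrow> real"
  assumes indep: "indep_vars (\<lambda>_. borel) X {1..}"
    and distr: "\<And>i. i \<ge> 1 \<Longrightarrow> distr M borel (X i) = distr M borel Y"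
    and Y: "random_variable borel Y" "AE \<omega> in M. Y \<omega> \<in> {a..b}" and "a < b"
  shows "AE \<omega> in M. (\<lambda>n. (\<Sum>i=1..n. X i \<omega>) / real n) \<longlonglongrightarrow> expectation Y"
proof -
  define \<mu> where "\<mu> = expectation Y"
  have X [measurable]: "X i \<in> borel_measurable M" if "i \<in> {1..n}" for i n
    using indep that unfolding indep_vars_def by auto
  \<comment> \<open>Using \<open>Suc n\<close> excludes the empty sample, where the mean would be a
    division by zero; the index is shifted back at the end.\<close>
  define dev where "dev \<omega> n = \<bar>(\<Sum>i=1..Suc n. X i \<omega>) / real (Suc n) - \<mu>\<bar>" for \<omega> n
  have ev: "AE \<omega> in M. \<forall>\<^sub>F n in sequentially. dev \<omega> n < e" if "e > 0" for e
  proof -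
    define A where "A n = {\<omega> \<in> space M. dev \<omega> n \<ge> e}" for n
    define c where "c = exp (- 2 * e\<^sup>2 / (b - a)\<^sup>2)"
    have bound: "prob (A n) \<le> 2 * c ^ Suc n" for n
    proof -
      interpret H: Hoeffding_ineq_iid M "{1..Suc n}" X Y a b \<mu>
      proof unfold_locales
        show "indep_vars (\<lambda>_. borel) X {1..Suc n}"
          by (rule indep_vars_subset[OF indep]) auto
      qed (use distr Y in \<open>auto simp: \<mu>_def\<close>)
      have "prob (A n) \<le> 2 * exp (- 2 * real (Suc n) * e\<^sup>2 / (b - a)\<^sup>2)"
        using H.Hoeffding_ineq_abs_ge'[of e] that \<open>a < b\<close> by (simp add: A_def dev_def)
      also have "- 2 * real (Suc n) * e\<^sup>2 / (b - a)\<^sup>2 = real (Suc n) * (- 2 * e\<^sup>2 / (b - a)\<^sup>2)"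
        by (simp only: times_divide_eq_right mult_ac)
      also have "exp \<dots> = c ^ Suc n"
        unfolding c_def by (rule exp_of_nat_mult)
      finally show ?thesis .
    qed
    have "0 \<le> c" "c < 1"
      using that \<open>a < b\<close> by (auto simp: c_def)
    then have "summable (\<lambda>n. 2 * c ^ Suc n)"
      by (intro summable_mult) (simp add: summable_geometric summable_mult)
    then have "summable (\<lambda>n. prob (A n))"
      by (rule summable_comparison_test'[where N = 0]) (use bound in auto)
    moreover have "A n \<in> sets M" for n
      unfolding A_def dev_def by measurable
    ultimately have "AE \<omega> in M. \<forall>\<^sub>F n in sequentially. \<omega> \<in> space M - A n"
      by (intro borel_cantelli_AE1) (auto simp: emeasure_eq_measure)
    then show ?thesis
      by (rule eventually_mono) (auto elim!: eventually_mono simp: A_def)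
  qed
  \<comment> \<open>Countably many tolerances allow the exceptional null sets to be united.\<close>
  have "AE \<omega> in M. \<forall>m. \<forall>\<^sub>F n in sequentially. dev \<omega> n < inverse (real (Suc m))"
    unfolding AE_all_countable by (intro allI ev) simp
  then show ?thesis
  proof (rule eventually_mono)
    fix \<omega> assume *: "\<forall>m. \<forall>\<^sub>F n in sequentially. dev \<omega> n < inverse (real (Suc m))"
    have "(\<lambda>n. (\<Sum>i=1..Suc n. X i \<omega>) / real (Suc n)) \<longlonglongrightarrow> \<mu>"
    proof (rule tendstoI)
      fix e :: real assume "e > 0"
      then obtain m where m: "inverse (real (Suc m)) < e"
        using reals_Archimedean by blast
      show "\<forall>\<^sub>F n in sequentially. dist ((\<Sum>i=1..Suc n. X i \<omega>) / real (Suc n)) \<mu> < e"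
        using *[rule_format, of m] by (rule eventually_mono) (use m in \<open>simp add: dev_def dist_real_def\<close>)
    qed
    then show "(\<lambda>n. (\<Sum>i=1..n. X i \<omega>) / real n) \<longlonglongrightarrow> expectation Y"
      unfolding \<mu>_def by (subst (asm) filterlim_sequentially_Suc)
  qed
qed

text \<open>Composition with the indicator of \<open>A\<close> preserves independence and equality
  of distributions, and gives values in \<open>[0, 1]\<close> with the probability as mean.\<close>

lemma strong_law_frequency:
  assumes indep: "indep_vars (\<lambda>_. N) Z {1..}"
    and distr: "\<And>i. i \<ge> 1 \<Longrightarrow> distr M N (Z i) = distr M N Z0"
    and Z0 [measurable]: "random_variable N Z0" and A [measurable]: "A \<in> sets N"
  shows "AE \<omega> in M. (\<lambda>n. (\<Sum>i=1..n. indicat_real A (Z i \<omega>)) / real n)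
    \<longlonglongrightarrow> prob {\<omega> \<in> space M. Z0 \<omega> \<in> A}"
proof -
  have Z: "random_variable N (Z i)" if "i \<ge> 1" for i
    using indep that unfolding indep_vars_def by auto
  have "indep_vars (\<lambda>_. borel) (\<lambda>i \<omega>. indicat_real A (Z i \<omega>)) {1..}"
    by (rule indep_vars_compose2[OF indep]) measurable
  moreover have "distr M borel (\<lambda>\<omega>. indicat_real A (Z i \<omega>)) =
      distr M borel (\<lambda>\<omega>. indicat_real A (Z0 \<omega>))" if "i \<ge> 1" for i
  proof -
    have "distr M borel (\<lambda>\<omega>. indicat_real A (Z i \<omega>)) = distr (distr M N (Z i)) borel (indicat_real A)"
      using Z[OF that] by (subst distr_distr) (auto simp: comp_def)
    also have "\<dots> = distr M borel (\<lambda>\<omega>. indicat_real A (Z0 \<omega>))"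
      unfolding distr[OF that] by (subst distr_distr) (auto simp: comp_def)
    finally show ?thesis .
  qed
  ultimately have "AE \<omega> in M. (\<lambda>n. (\<Sum>i=1..n. indicat_real A (Z i \<omega>)) / real n)
      \<longlonglongrightarrow> expectation (\<lambda>\<omega>. indicat_real A (Z0 \<omega>))"
    by (rule strong_law_bounded_iid[where a = 0 and b = 1])
      (auto simp: indicator_def)
  also have "expectation (\<lambda>\<omega>. indicat_real A (Z0 \<omega>)) =
      expectation (indicat_real {\<omega> \<in> space M. Z0 \<omega> \<in> A})"
    by (rule Bochner_Integration.integral_cong) (auto simp: indicator_def)
  also have "\<dots> = prob {\<omega> \<in> space M. Z0 \<omega> \<in> A}"
    by (simp add: Int_absorb1)
  finally show ?thesis .
qed

section \<open>Monotonicity, limit at infinity and continuity of the cumulative incidence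
  functions\<close>

lemma mono_cumulative_incidence:
  assumes [measurable]: "T \<in> borel_measurable M" "\<delta> \<in> measurable M (count_space UNIV)"
  shows "mono (cumulative_incidence M T \<delta> j)"
  unfolding cumulative_incidence_def by (intro monoI finite_measure_mono) auto

text \<open>By monotonicity it is enough to let time run through the integers, along which the
  events increase to \<open>\<delta> \<omega> = j\<close>.\<close>

lemma cumulative_incidence_tendsto_at_top:
  assumes [measurable]: "T \<in> borel_measurable M" "\<delta> \<in> measurable M (count_space UNIV)"
  shows "(cumulative_incidence M T \<delta> j \<longlongrightarrow> prob {\<omega> \<in> space M. \<delta> \<omega> = j}) at_top"
proof (rule tendsto_at_topI_sequentially_real)
  show "mono (cumulative_incidence M T \<delta> j)"
    using assms by (rule mono_cumulative_incidence)
  have "(\<lambda>n. prob {\<omega> \<in> space M. T \<omega> \<le> real n \<and> \<delta> \<omega> = j})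
      \<longlonglongrightarrow> prob (\<Union>n. {\<omega> \<in> space M. T \<omega> \<le> real n \<and> \<delta> \<omega> = j})"
    by (rule finite_Lim_measure_incseq) (auto simp: incseq_def)
  also have "(\<Union>n. {\<omega> \<in> space M. T \<omega> \<le> real n \<and> \<delta> \<omega> = j}) = {\<omega> \<in> space M. \<delta> \<omega> = j}"
    using real_arch_simple by auto
  finally show "(\<lambda>n. cumulative_incidence M T \<delta> j (real n)) \<longlonglongrightarrow> prob {\<omega> \<in> space M. \<delta> \<omega> = j}"
    unfolding cumulative_incidence_def .
qed

text \<open>Each increment for a single cause is dominated by the increment of the distribution
  function of \<open>T\<close>, so continuity is inherited.\<close>

lemma continuous_cumulative_incidence:
  assumes [measurable]: "T \<in> borel_measurable M" "\<delta> \<in> measurable M (count_space UNIV)"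
    and cont: "continuous_on UNIV (cdf (distr M borel T))"
  shows "continuous_on UNIV (cumulative_incidence M T \<delta> j)"
proof -
  have cdf: "cdf (distr M borel T) t = prob {\<omega> \<in> space M. T \<omega> \<le> t}" for t
    unfolding cdf_def by (subst measure_distr) (auto intro!: arg_cong[of _ _ prob])
  have le: "cumulative_incidence M T \<delta> j t - cumulative_incidence M T \<delta> j s
      \<le> cdf (distr M borel T) t - cdf (distr M borel T) s" if "s \<le> t" for s t
  proof -
    have "cumulative_incidence M T \<delta> j t - cumulative_incidence M T \<delta> j s =
        prob ({\<omega> \<in> space M. T \<omega> \<le> t \<and> \<delta> \<omega> = j} - {\<omega> \<in> space M. T \<omega> \<le> s \<and> \<delta> \<omega> = j})"
      unfolding cumulative_incidence_def by (rule finite_measure_Diff[symmetric]) (use that in auto)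
    also have "\<dots> \<le> prob ({\<omega> \<in> space M. T \<omega> \<le> t} - {\<omega> \<in> space M. T \<omega> \<le> s})"
      by (intro finite_measure_mono) auto
    also have "\<dots> = cdf (distr M borel T) t - cdf (distr M borel T) s"
      unfolding cdf by (rule finite_measure_Diff) (use that in auto)
    finally show ?thesis .
  qed
  have dist_le: "dist (cumulative_incidence M T \<delta> j s) (cumulative_incidence M T \<delta> j t)
      \<le> dist (cdf (distr M borel T) s) (cdf (distr M borel T) t)" for s t
    using le[of s t] le[of t s] monoD[OF mono_cumulative_incidence[OF assms(1,2)], of s t j]
      monoD[OF mono_cumulative_incidence[OF assms(1,2)], of t s j]
    by (cases "s \<le> t") (auto simp: dist_real_def)
  show ?thesis
    unfolding continuous_on_iff
  proof (intro ballI allI impI)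
    fix x e :: real assume "e > 0"
    then obtain d where "d > 0" "\<And>y. dist y x < d \<Longrightarrow>
        dist (cdf (distr M borel T) y) (cdf (distr M borel T) x) < e"
      using cont unfolding continuous_on_iff by (metis UNIV_I)
    then show "\<exists>d>0. \<forall>y\<in>UNIV. dist y x < d \<longrightarrow>
        dist (cumulative_incidence M T \<delta> j y) (cumulative_incidence M T \<delta> j x) < e"
      using dist_le by (meson le_less_trans)
  qed
qed

section \<open>Uniform consistency of the unrestricted estimators\<close>

lemma empirical_cif_uniform_limit:
  assumes T [measurable]: "T \<in> borel_measurable M"
    and \<delta> [measurable]: "\<delta> \<in> measurable M (count_space UNIV)"
    and cont: "continuous_on UNIV (cdf (distr M borel T))"
    and indep: "indep_vars (\<lambda>_. borel \<Otimes>\<^sub>M count_space UNIV) (\<lambda>i \<omega>. (Ts i \<omega>, \<delta>s i \<omega>)) {1..}"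
    and distr: "\<And>i. i \<ge> 1 \<Longrightarrow>
      distr M (borel \<Otimes>\<^sub>M count_space UNIV) (\<lambda>\<omega>. (Ts i \<omega>, \<delta>s i \<omega>)) =
      distr M (borel \<Otimes>\<^sub>M count_space UNIV) (\<lambda>\<omega>. (T \<omega>, \<delta> \<omega>))"
  shows "AE \<omega> in M. \<forall>j. uniform_limit {0..} (\<lambda>n. empirical_cif Ts \<delta>s n \<omega> j)
    (cumulative_incidence M T \<delta> j) sequentially"
  unfolding AE_all_countable
proof
  fix j
  \<comment> \<open>The choice \<open>B = {..q}\<close> yields the estimator at time
    \<open>q\<close>; \<open>B = UNIV\<close> yields the overall frequency of cause
    \<open>j\<close>, which serves as its value at infinity.\<close>
  have freq: "AE \<omega> in M. (\<lambda>n. (\<Sum>i=1..n. indicat_real (B \<times> {j}) (Ts i \<omega>, \<delta>s i \<omega>)) / real n)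
      \<longlonglongrightarrow> prob {\<omega> \<in> space M. (T \<omega>, \<delta> \<omega>) \<in> B \<times> {j}}" if "B \<in> sets borel" for B
    using that by (intro strong_law_frequency[OF indep distr]) auto
  have "AE \<omega> in M. \<forall>q\<in>\<rat>. (\<lambda>n. empirical_cif Ts \<delta>s n \<omega> j q) \<longlonglongrightarrow> cumulative_incidence M T \<delta> j q"
  proof (rule AE_ball_countable'[OF _ countable_rat])
    fix q
    show "AE \<omega> in M. (\<lambda>n. empirical_cif Ts \<delta>s n \<omega> j q) \<longlonglongrightarrow> cumulative_incidence M T \<delta> j q"
      using freq[of "{..q}"]
      by (simp add: empirical_cif_def cumulative_incidence_def indicator_def of_bool_def)
  qed
  moreover define H where "H \<omega> = (\<lambda>n. (\<Sum>i=1..n. of_bool (\<delta>s i \<omega> = j)) / real n)" for \<omega>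
  have "AE \<omega> in M. H \<omega> \<longlonglongrightarrow> prob {\<omega> \<in> space M. \<delta> \<omega> = j}"
    using freq[of UNIV] by (simp add: H_def indicator_def of_bool_def)
  ultimately show "AE \<omega> in M. uniform_limit {0..} (\<lambda>n. empirical_cif Ts \<delta>s n \<omega> j)
      (cumulative_incidence M T \<delta> j) sequentially"
  proof eventually_elim
    case (elim \<omega>)
    show ?case
    proof (rule uniform_limit_monotone_rational)
      show "empirical_cif Ts \<delta>s n \<omega> j t \<le> H \<omega> n" for n t
        unfolding empirical_cif_def H_def times_divide_eq_left mult_1
        by (intro divide_right_mono sum_mono) auto
      show "continuous_on {0..} (cumulative_incidence M T \<delta> j)"
        using continuous_cumulative_incidence[OF T \<delta> cont] by (rule continuous_on_subset) simp
      show "mono_on {0..} (cumulative_incidence M T \<delta> j)"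
        using mono_cumulative_incidence[OF T \<delta>] by (rule mono_on_subset) simp
      show "mono_on {0..} (empirical_cif Ts \<delta>s n \<omega> j)" for n
        using mono_empirical_cif by (rule mono_on_subset) simp
    qed (use elim cumulative_incidence_tendsto_at_top[OF T \<delta>] in auto)
  qed
qed

section \<open>Measurability of the supremum-norm error\<close>

lemma sup_norm_restricted_cif_measurable:
  assumes Ts: "\<And>i. i \<ge> 1 \<Longrightarrow> Ts i \<in> borel_measurable M"
    and \<delta>s: "\<And>i. i \<ge> 1 \<Longrightarrow> \<delta>s i \<in> measurable M (count_space UNIV)"
    and cont: "continuous_on UNIV F" and F: "\<And>t. F t \<in> {0..1}" and i: "i \<in> {1..k}"
  shows "(\<lambda>\<omega>. sup_norm (\<lambda>t. restricted_cif k Ts \<delta>s n \<omega> i t - F t)) \<in> borel_measurable M"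
proof -
  have emp [measurable]: "(\<lambda>\<omega>. empirical_cif Ts \<delta>s n \<omega> j t) \<in> borel_measurable M" for j t
    unfolding empirical_cif_def
  proof (intro borel_measurable_times borel_measurable_const borel_measurable_sum)
    fix i assume "i \<in> {1..n}"
    then have [measurable]: "Ts i \<in> borel_measurable M" "\<delta>s i \<in> measurable M (count_space UNIV)"
      using Ts \<delta>s by auto
    show "(\<lambda>\<omega>. of_bool (Ts i \<omega> \<le> t \<and> \<delta>s i \<omega> = j) :: real) \<in> borel_measurable M"
      by measurable
  qed
  have res: "(\<lambda>\<omega>. restricted_cif k Ts \<delta>s n \<omega> i t) \<in> borel_measurable M" for t
    unfolding restricted_cif_def by measurable
  have bound: "\<bar>restricted_cif k Ts \<delta>s n \<omega> i t - F t\<bar> \<le> 1" for \<omega> t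
    using F[of t] by (intro abs_restricted_cif_diff_le_1[OF i]) auto
  have "sup_norm (\<lambda>t. restricted_cif k Ts \<delta>s n \<omega> i t - F t) =
      (SUP q\<in>\<rat> \<inter> {0..}. \<bar>restricted_cif k Ts \<delta>s n \<omega> i q - F q\<bar>)" for \<omega>
  proof (rule sup_norm_eq_SUP_rational)
    fix t e :: real assume "t \<ge> 0" "e > 0"
    \<comment> \<open>Within distance \<open>d\<close> of \<open>t\<close>, \<open>F\<close> moves
      by less than \<open>e\<close>, while the estimator takes exactly the same value at a suitable
      rational to the right.\<close>
    obtain d where "d > 0" and d: "\<And>y. dist y t < d \<Longrightarrow> dist (F y) (F t) < e"
      using cont \<open>e > 0\<close> unfolding continuous_on_iff by (metis UNIV_I)
    obtain q where q: "q \<in> \<rat>" "t < q" "q < t + d"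
        "restricted_cif k Ts \<delta>s n \<omega> i q = restricted_cif k Ts \<delta>s n \<omega> i t"
      using restricted_cif_rational_right[OF \<open>d > 0\<close>] by metis
    have "\<bar>F q - F t\<bar> < e"
      using d[of q] q by (simp add: dist_real_def)
    then show "\<exists>q\<in>\<rat>. q \<ge> 0 \<and> \<bar>restricted_cif k Ts \<delta>s n \<omega> i t - F t\<bar>
        \<le> \<bar>restricted_cif k Ts \<delta>s n \<omega> i q - F q\<bar> + e"
      using q \<open>t \<ge> 0\<close> by (intro bexI[of _ q]) auto
  qed (rule bound)
  moreover have "(\<lambda>\<omega>. SUP q\<in>\<rat> \<inter> {0..}. \<bar>restricted_cif k Ts \<delta>s n \<omega> i q - F q\<bar>) \<in> borel_measurable M"
    using res bound
    by (intro borel_measurable_cSUP borel_measurable_abs borel_measurable_diff borel_measurable_const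
        bdd_aboveI2[of _ _ 1] countable_Int1 countable_rat) auto
  ultimately show ?thesis
    by simp
qed

end

section \<open>Passage from the unrestricted to the restricted estimators\<close>

text \<open>The projection onto the ordered cone does not increase the maximum-norm distance to a
  vector in the cone, so the bound \<open>e\<close> is retained without loss.\<close>

lemma restricted_cif_close:
  assumes i: "i \<in> {1..k}" and mono: "mono_on {1..k} f"
    and close: "\<And>j. j \<in> {1..k} \<Longrightarrow> \<bar>empirical_cif Ts \<delta>s n \<omega> j t - f j\<bar> \<le> e"
  shows "\<bar>restricted_cif k Ts \<delta>s n \<omega> i t - f i\<bar> \<le> e"
proof -
  have "f i - e \<le> restricted_cif k Ts \<delta>s n \<omega> i t"
  proof (rule restricted_cif_ge[OF i])
    fix j assume "j \<in> {i..k}"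
    with i have "f i \<le> f j" "j \<in> {1..k}"
      using mono by (auto simp: mono_on_def)
    with close[of j] show "f i - e \<le> empirical_cif Ts \<delta>s n \<omega> j t"
      by linarith
  qed
  moreover have "restricted_cif k Ts \<delta>s n \<omega> i t \<le> f i + e"
  proof (rule restricted_cif_le[OF i])
    fix j assume "j \<in> {1..i}"
    with i have "f j \<le> f i" "j \<in> {1..k}"
      using mono by (auto simp: mono_on_def)
    with close[of j] show "empirical_cif Ts \<delta>s n \<omega> j t \<le> f i + e"
      by linarith
  qed
  ultimately show ?thesis
    by linarith
qed

lemma restricted_cif_sup_norm_LIMSEQ:
  assumes i: "i \<in> {1..k}" and mono: "\<And>t. t \<ge> 0 \<Longrightarrow> mono_on {1..k} (\<lambda>j. F j t)"
    and lim: "\<And>j. uniform_limit {0..} (\<lambda>n. empirical_cif Ts \<delta>s n \<omega> j) (F j) sequentially"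
  shows "(\<lambda>n. sup_norm (\<lambda>t. restricted_cif k Ts \<delta>s n \<omega> i t - F i t)) \<longlonglongrightarrow> 0"
proof (rule sup_norm_LIMSEQ_0I)
  fix e :: real assume "e > 0"
  \<comment> \<open>Only finitely many causes occur, so one threshold for \<open>n\<close> serves
    them all.\<close>
  have "\<forall>\<^sub>F n in sequentially. \<forall>j\<in>{1..k}. \<forall>t\<in>{0..}. dist (empirical_cif Ts \<delta>s n \<omega> j t) (F j t) < e"
    using uniform_limitD[OF lim \<open>e > 0\<close>] by (intro eventually_ball_finite) auto
  then show "\<forall>\<^sub>F n in sequentially. \<forall>t\<ge>0. \<bar>restricted_cif k Ts \<delta>s n \<omega> i t - F i t\<bar> \<le> e"
  proof eventually_elim
    case (elim n)
    show ?case
    proof (intro allI impI)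
      fix t :: real assume "t \<ge> 0"
      then show "\<bar>restricted_cif k Ts \<delta>s n \<omega> i t - F i t\<bar> \<le> e"
        using elim by (intro restricted_cif_close[OF i mono]) (auto simp: dist_real_def less_imp_le)
    qed
  qed
qed

theorem theorem2p1:
  fixes M :: "'a measure"
    and k :: nat
    and T :: "'a \<Rightarrow> real" and \<delta> :: "'a \<Rightarrow> nat"
    and Ts :: "nat \<Rightarrow> 'a \<Rightarrow> real" and \<delta>s :: "nat \<Rightarrow> 'a \<Rightarrow> nat"
  assumes "prob_space M"
    and "k \<ge> 3"
    and "T \<in> borel_measurable M"
    and "\<delta> \<in> measurable M (count_space UNIV)"
    and "AE \<omega> in M. T \<omega> \<ge> 0"
    and "AE \<omega> in M. \<delta> \<omega> \<in> {1..k}"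
    and "continuous_on UNIV (cdf (distr M borel T))"
    and "prob_space.indep_vars M (\<lambda>_. borel \<Otimes>\<^sub>M count_space UNIV)
           (\<lambda>i \<omega>. (Ts i \<omega>, \<delta>s i \<omega>)) {1..}"
    and "\<And>i. i \<ge> 1 \<Longrightarrow>
           distr M (borel \<Otimes>\<^sub>M count_space UNIV) (\<lambda>\<omega>. (Ts i \<omega>, \<delta>s i \<omega>)) =
           distr M (borel \<Otimes>\<^sub>M count_space UNIV) (\<lambda>\<omega>. (T \<omega>, \<delta> \<omega>))"
    and "\<And>t j. t \<ge> 0 \<Longrightarrow> j \<in> {1..<k} \<Longrightarrow>
           cumulative_incidence M T \<delta> j t \<le> cumulative_incidence M T \<delta> (j + 1) t"
  shows "measure M {\<omega> \<in> space M. \<forall>i\<in>{1..k}.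
           (\<lambda>n. sup_norm (\<lambda>t. restricted_cif k Ts \<delta>s n \<omega> i t - cumulative_incidence M T \<delta> i t))
             \<longlonglongrightarrow> 0} = 1"
proof -
  interpret prob_space M
    by fact
  let ?F = "cumulative_incidence M T \<delta>"
  let ?conv = "\<lambda>\<omega>. \<forall>i\<in>{1..k}.
    (\<lambda>n. sup_norm (\<lambda>t. restricted_cif k Ts \<delta>s n \<omega> i t - ?F i t)) \<longlonglongrightarrow> 0"
  \<comment> \<open>Independence includes measurability of the observed pairs, for indices from
    \<open>1\<close> on.\<close>
  have obs: "(\<lambda>\<omega>. (Ts i \<omega>, \<delta>s i \<omega>)) \<in> measurable M (borel \<Otimes>\<^sub>M count_space UNIV)" if "i \<ge> 1" for i
    using assms(8) that unfolding indep_vars_def by auto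
  have Ts: "Ts i \<in> borel_measurable M" if "i \<ge> 1" for i
    using measurable_compose[OF obs[OF that] measurable_fst] by simp
  have \<delta>s: "\<delta>s i \<in> measurable M (count_space UNIV)" if "i \<ge> 1" for i
    using measurable_compose[OF obs[OF that] measurable_snd] by simp
  \<comment> \<open>Measurability of the event allows the almost sure statement to be turned into
    probability one.\<close>
  have "Measurable.pred M (\<lambda>\<omega>. (\<lambda>n. sup_norm (\<lambda>t. restricted_cif k Ts \<delta>s n \<omega> i t - ?F i t)) \<longlonglongrightarrow> 0)"
    if "i \<in> {1..k}" for i
    by (intro pred_LIMSEQ_real sup_norm_restricted_cif_measurable Ts \<delta>s that
        continuous_cumulative_incidence assms) (auto simp: cumulative_incidence_def)
  then have "Measurable.pred M ?conv"
    by (intro pred_intros_finite) auto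
  moreover have "mono_on {1..k} (\<lambda>j. ?F j t)" if "t \<ge> 0" for t
  proof (rule mono_onI)
    fix i j assume "i \<in> {1..k}" "j \<in> {1..k}" "i \<le> j"
    \<comment> \<open>The bound \<open>j \<le> k\<close> is part of the induction claim, so that
      each step can use the ordering of consecutive causes.\<close>
    from \<open>i \<le> j\<close> have "j \<le> k \<longrightarrow> ?F i t \<le> ?F j t"
    proof (induction j rule: dec_induct)
      case (step j)
      then show ?case
        using assms(10)[OF that, of j] \<open>i \<in> {1..k}\<close> by auto
    qed simp
    then show "?F i t \<le> ?F j t"
      using \<open>j \<in> {1..k}\<close> by simp
  qed
  then have "AE \<omega> in M. ?conv \<omega>"
    using empirical_cif_uniform_limit[OF assms(3,4,7,8,9)]
    by (auto elim!: eventually_mono intro: restricted_cif_sup_norm_LIMSEQ)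
  ultimately show ?thesis
    by (subst prob_Collect_eq_1) auto
qed

end
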